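(* Let $n \geq 2$, let $D=(d_1,\dots,d_n) \in [m]^n$ and $k \in [m]$. Then \[ p_{\textsc{Bins}(k)}(D) = \Theta\Big(\min\Big(1 , \frac{\|D\|_1^2 - \|D\|_2^2}{km} + \frac{n \|D\|_1}{m} + \frac{n^2 k}{m} \Big)\Big). \]
   Context: Fix $m\in\mathbb N$ and the universe of IDs $[m]=\{1,\dots,m\}$. An ID-generation algorithm $\mathcal A$ is a probability distribution over permutations of $[m]$: an instance of $\mathcal A$ draws a permutation and answers its $t$-th request with the $t$-th entry. A demand profile $D=(d_1,\dots,d_n)\in[m]^n$ means that $n$ instances of $\mathcal A$ with independent randomness are run and instance $i$ receives $d_i$ requests. A collision occurs if the sets of IDs output by the $n$ instances are not pairwise disjoint; $p_{\mathcal A}(D)$ is the collision probability. $\|D\|_1=\sum_i d_i$, $\|D\|_2^2=\sum_i d_i^2$. Algorithm $\textsc{Bins}(k)$: fix a partition of $[m]$ into $\lfloor m/k\rfloor$ bins of $k$ IDs each and $m \bmod k$ leftover IDs; pick a uniformly random permutation of the bins, iterate over the shuffled bins returning all IDs of a bin in increasing order before moving to the next bin, and finally return the leftover IDs in increasing order. Asymptotic notation is non-asymptotic: $f=O(g)$ means there is an absolute constant $c>0$, independent of all parameters, with $f\le c\,g$ always; $\Omega$ is the reverse and $\Theta$ means both. *)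

theory Defs
  imports "HOL-Probability.Probability" "HOL-Combinatorics.Multiset_Permutations"
begin

text \<open>A permutation of \<open>[m]\<close> is a duplicate-free list enumerating \<open>{1..m}\<close>, in the order in which
  the IDs are returned.\<close>

definition id_algorithm :: "nat \<Rightarrow> nat list pmf \<Rightarrow> bool" where
  "id_algorithm m A \<longleftrightarrow> set_pmf A \<subseteq> permutations_of_set {1..m}"

definition collision :: "nat \<Rightarrow> (nat \<Rightarrow> nat) \<Rightarrow> (nat \<Rightarrow> nat list) \<Rightarrow> bool" where
  "collision n D \<pi> \<longleftrightarrow> \<not> disjoint_family_on (\<lambda>i. set (take (D i) (\<pi> i))) {1..n}"

text \<open>A demand profile \<open>(d\<^sub>1, \<dots>, d\<^sub>n)\<close> is a function of which only the values on \<open>{1..n}\<close> matter.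
  The empty list is the value that \<^const>\<open>Pi_pmf\<close> assigns to indices outside \<open>{1..n}\<close>.\<close>

definition collision_prob :: "nat list pmf \<Rightarrow> nat \<Rightarrow> (nat \<Rightarrow> nat) \<Rightarrow> real" where
  "collision_prob A n D =
     measure_pmf.prob (Pi_pmf {1..n} [] (\<lambda>_. A)) {\<pi>. collision n D \<pi>}"

definition norm1 :: "nat \<Rightarrow> (nat \<Rightarrow> nat) \<Rightarrow> real" where
  "norm1 n D = (\<Sum>i=1..n. real (D i))"

definition norm2_sq :: "nat \<Rightarrow> (nat \<Rightarrow> nat) \<Rightarrow> real" where
  "norm2_sq n D = (\<Sum>i=1..n. (real (D i))\<^sup>2)"

text \<open>\<open>\<B>\<close> is the set of bins and \<open>L\<close> the set of leftover IDs.\<close>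

definition bin_partition :: "nat \<Rightarrow> nat \<Rightarrow> nat set set \<Rightarrow> nat set \<Rightarrow> bool" where
  "bin_partition m k \<B> L \<longleftrightarrow>
     disjoint \<B> \<and> \<Union>\<B> \<inter> L = {} \<and> \<Union>\<B> \<union> L = {1..m} \<and>
     card \<B> = m div k \<and> (\<forall>b\<in>\<B>. card b = k) \<and> card L = m mod k"

definition bins :: "nat set set \<Rightarrow> nat set \<Rightarrow> nat list pmf" where
  "bins \<B> L =
     map_pmf (\<lambda>bs. concat (map sorted_list_of_set bs) @ sorted_list_of_set L)
       (pmf_of_set (permutations_of_set \<B>))"

lemma id_algorithm_bins:
  assumes P: "bin_partition m k \<B> L"
  shows "id_algorithm m (bins \<B> L)"
proof -
  have cov: "\<Union>\<B> \<union> L = {1..m}" and dis: "disjoint \<B>" and disL: "\<Union>\<B> \<inter> L = {}"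
    using P by (auto simp: bin_partition_def)
  have fin: "finite (\<Union>\<B> \<union> L)" unfolding cov by simp
  have finB: "finite \<B>" using fin by (auto intro: finite_UnionD)
  have finb: "finite b" if "b \<in> \<B>" for b
    using fin that by (meson Union_upper finite_Un finite_subset)
  have "concat (map sorted_list_of_set bs) @ sorted_list_of_set L \<in> permutations_of_set {1..m}"
    if "bs \<in> permutations_of_set \<B>" for bs
  proof -
    have bs: "set bs = \<B>" "distinct bs"
      using that by (auto simp: permutations_of_set_def)
    have inj: "inj_on sorted_list_of_set \<B>"
      by (metis finb inj_onI set_sorted_list_of_set)
    have "distinct (concat (map sorted_list_of_set bs))"
    proof (rule distinct_concat)
      show "distinct (map sorted_list_of_set bs)"
        using bs inj by (simp add: distinct_map)
      show "distinct ys" if "ys \<in> set (map sorted_list_of_set bs)" for ys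
        using that by auto
      show "set ys \<inter> set zs = {}"
        if "ys \<in> set (map sorted_list_of_set bs)" "zs \<in> set (map sorted_list_of_set bs)"
          "ys \<noteq> zs" for ys zs
      proof -
        obtain a b where ab: "a \<in> \<B>" "b \<in> \<B>"
          "ys = sorted_list_of_set a" "zs = sorted_list_of_set b"
          using \<open>ys \<in> _\<close> \<open>zs \<in> _\<close> bs(1) by auto
        then have "a \<inter> b = {}"
          using dis \<open>ys \<noteq> zs\<close> by (metis disjointD)
        then show ?thesis
          using ab finb by simp
      qed
    qed
    moreover have "set (concat (map sorted_list_of_set bs)) = \<Union>\<B>"
      using bs finb by simp
    moreover have "finite L"
      using fin by simp
    ultimately show ?thesis
      using cov disL by (simp add: permutations_of_set_def)
  qed
  then show ?thesis
    using finB by (auto simp: id_algorithm_def bins_def set_pmf_of_set)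
qed

end

theory Submission imports Defs
begin

text \<open>Let \<open>N = m div k\<close> be the number of bins. Instance \<open>i\<close> opens a uniformly random set of
  \<open>h\<^sub>i = min N \<lceil>d\<^sub>i / k\<rceil>\<close> bins, and each opened bin yields its least ID, so a collision occurs exactly
  when two instances open a common bin. Exposing the instances one after another, and the bins of an
  instance one after another, gives \<open>1 - e/N \<le> P(no collision) \<le> exp (- e/N)\<close> for
  \<open>e = \<Sum>\<^bsub>i<j\<^esub> h\<^sub>i h\<^sub>j\<close>. Finally \<open>h\<^sub>i\<close> is \<open>d\<^sub>i/k + 1\<close> and \<open>N\<close> is \<open>m/k\<close> up to constant factors, and
  expanding \<open>\<Sum>\<^bsub>i<j\<^esub> (d\<^sub>i/k + 1) (d\<^sub>j/k + 1) k/m\<close> gives the three terms of the bound.\<close>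

section \<open>Probabilities under two-stage draws\<close>

lemma prob_bind_pmf:
  "measure_pmf.prob (bind_pmf p f) X = measure_pmf.expectation p (\<lambda>x. measure_pmf.prob (f x) X)"
proof -
  have "ennreal (measure_pmf.prob (bind_pmf p f) X) = (\<integral>\<^sup>+x. ennreal (measure_pmf.prob (f x) X) \<partial>p)"
    by (simp flip: measure_pmf.emeasure_eq_measure)
  also have "\<dots> = ennreal (measure_pmf.expectation p (\<lambda>x. measure_pmf.prob (f x) X))"
    by (intro nn_integral_eq_integral measure_pmf.integrable_const_bound[where B = 1]) auto
  finally show ?thesis
    by simp
qed

text \<open>Serves to condition on the first stage: the bounds \<open>a\<close> and \<open>b\<close>
  are required only on the good event \<open>E\<close>, outside of which \<open>X\<close> is
  impossible. Below, \<open>E\<close> says that the instances exposed so far use disjoint sets. The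
  value \<open>a\<close> may be negative, as happens for \<open>1 - y\<close>.\<close>

lemma prob_bind_pmf_bounds:
  assumes zero: "\<And>x. x \<in> set_pmf p \<Longrightarrow> x \<notin> E \<Longrightarrow> measure_pmf.prob (f x) X = 0"
    and lower: "\<And>x. x \<in> set_pmf p \<Longrightarrow> x \<in> E \<Longrightarrow> a \<le> measure_pmf.prob (f x) X"
    and upper: "\<And>x. x \<in> set_pmf p \<Longrightarrow> x \<in> E \<Longrightarrow> measure_pmf.prob (f x) X \<le> b"
  shows "measure_pmf.prob p E * a \<le> measure_pmf.prob (bind_pmf p f) X"
    and "measure_pmf.prob (bind_pmf p f) X \<le> measure_pmf.prob p E * b"
proof -
  have int: "integrable p (\<lambda>x. measure_pmf.prob (f x) X)"
    by (rule measure_pmf.integrable_const_bound[where B = 1]) auto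
  have intE: "integrable p (\<lambda>x. indicator E x * c)" for c :: real
    by (rule measure_pmf.integrable_const_bound[where B = "\<bar>c\<bar>"]) (auto simp: indicator_def)
  have exp: "measure_pmf.expectation p (\<lambda>x. indicator E x * c) = measure_pmf.prob p E * c" for c :: real
    by simp
  show "measure_pmf.prob p E * a \<le> measure_pmf.prob (bind_pmf p f) X"
    unfolding prob_bind_pmf exp[symmetric]
    by (intro integral_mono_AE int intE)
       (auto simp: AE_measure_pmf_iff indicator_def zero lower)
  show "measure_pmf.prob (bind_pmf p f) X \<le> measure_pmf.prob p E * b"
    unfolding prob_bind_pmf exp[symmetric]
    by (intro integral_mono_AE int intE)
       (auto simp: AE_measure_pmf_iff indicator_def zero upper)
qed

section \<open>A random prefix against a fixed set\<close>

text \<open>The head of a uniform permutation is uniform on \<open>B\<close>, and the tail is then a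
  uniform permutation of what remains; heads in \<open>U\<close> contribute nothing.\<close>

lemma prob_random_permutation_prefix_avoids_Suc:
  assumes "finite B" "B \<noteq> {}"
  shows "measure_pmf.prob (pmf_of_set (permutations_of_set B)) {bs. set (take (Suc h) bs) \<inter> U = {}} =
    (\<Sum>x\<in>B - U. measure_pmf.prob (pmf_of_set (permutations_of_set (B - {x})))
                  {bs. set (take h bs) \<inter> U = {}}) / card B"
proof -
  let ?P = "\<lambda>x. measure_pmf.prob (pmf_of_set (permutations_of_set (B - {x})))
                  {bs. set (take h bs) \<inter> U = {}}"
  have "measure_pmf.prob (map_pmf ((#) x) (pmf_of_set (permutations_of_set (B - {x}))))
          {bs. set (take (Suc h) bs) \<inter> U = {}} = (if x \<in> U then 0 else ?P x)" for x
    by (simp add: vimage_def)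
  moreover have "pmf_of_set (permutations_of_set B) =
      pmf_of_set B \<bind> (\<lambda>x. map_pmf ((#) x) (pmf_of_set (permutations_of_set (B - {x}))))"
    using random_permutation_of_set[OF assms] by (simp add: map_pmf_def)
  ultimately have "measure_pmf.prob (pmf_of_set (permutations_of_set B))
      {bs. set (take (Suc h) bs) \<inter> U = {}} = (\<Sum>x\<in>B. if x \<in> U then 0 else ?P x) / card B"
    using assms by (simp add: prob_bind_pmf integral_pmf_of_set del: take_Suc_Cons)
  also have "(\<Sum>x\<in>B. if x \<in> U then 0 else ?P x) = (\<Sum>x\<in>B - U. ?P x)"
    using assms by (intro sum.mono_neutral_cong_right) auto
  finally show ?thesis .
qed

text \<open>Induction on \<open>h\<close>, exposing one entry at a time. As long as \<open>U\<close>
  is avoided, only elements outside \<open>U\<close> are removed from \<open>B\<close>, so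
  \<open>U\<close> stays fixed while \<open>B\<close> shrinks; this is why \<open>B\<close> is
  generalised. The lower bound is of union-bound type, the upper one comes from
  \<open>1 - x \<le> exp (- x)\<close>.\<close>

lemma prob_random_permutation_prefix_avoids:
  assumes "finite B" "U \<subseteq> B" "h \<le> card B"
  shows "1 - real (card U) * real h / real (card B)
           \<le> measure_pmf.prob (pmf_of_set (permutations_of_set B)) {bs. set (take h bs) \<inter> U = {}}"
        (is "?low B h \<le> ?P B h")
    and "measure_pmf.prob (pmf_of_set (permutations_of_set B)) {bs. set (take h bs) \<inter> U = {}}
           \<le> exp (- (real (card U) * real h / real (card B)))" (is "_ \<le> ?up B h")
proof -
  have "?low B h \<le> ?P B h \<and> ?P B h \<le> ?up B h"
    using assms
  proof (induction h arbitrary: B)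
    case 0
    then show ?case by simp
  next
    case (Suc h)
    define N where "N = card B"
    define s where "s = card U"
    have N: "Suc h \<le> N" and B: "B \<noteq> {}"
      using Suc.prems by (auto simp: N_def)
    have "s \<le> N"
      unfolding N_def s_def using Suc.prems by (intro card_mono) auto
    have "finite U"
      using Suc.prems finite_subset by blast
    have card: "real (card (B - U)) = real N - real s"
      using Suc.prems \<open>finite U\<close> \<open>s \<le> N\<close> by (simp add: card_Diff_subset N_def s_def)
    have IH: "1 - s * h / real (N - 1) \<le> ?P (B - {x}) h"
      "?P (B - {x}) h \<le> exp (- (s * h / real (N - 1)))" if "x \<in> B - U" for x
    proof -
      have "U \<subseteq> B - {x}" "card (B - {x}) = N - 1"
        using Suc.prems that by (auto simp: N_def)
      then show "1 - s * h / real (N - 1) \<le> ?P (B - {x}) h"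
        "?P (B - {x}) h \<le> exp (- (s * h / real (N - 1)))"
        using Suc.IH[of "B - {x}"] Suc.prems N by (auto simp: s_def)
    qed
    have P: "?P B (Suc h) = (\<Sum>x\<in>B - U. ?P (B - {x}) h) / N"
      unfolding N_def using Suc.prems B by (intro prob_random_permutation_prefix_avoids_Suc)
    \<comment> \<open>For \<open>s > 0\<close> the factor \<open>N - s\<close> is at most
      \<open>N - 1\<close>, which cancels the smaller denominator left by the removed head. If
      \<open>N = 1\<close>, the division is by zero, but then \<open>h = 0\<close>.\<close>
    have frac: "real h / real (N - 1) * (real N - real s) \<le> real h" if "s > 0"
      using N that by (cases "N = 1") (auto simp: field_simps of_nat_diff mult_le_cancel_left1)
    have "1 - s * Suc h / N \<le> (real N - real s) * (1 - s * h / real (N - 1)) / N"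
    proof (cases "s = 0")
      case True
      then show ?thesis using N by simp
    next
      case False
      then have "real s * (real h / real (N - 1) * (real N - real s)) \<le> real s * real h"
        by (intro mult_left_mono frac) auto
      then have "real N - s * Suc h \<le> (real N - real s) * (1 - s * h / real (N - 1))"
        by (simp add: algebra_simps)
      then have "(real N - s * Suc h) / N \<le> (real N - real s) * (1 - s * h / real (N - 1)) / N"
        by (rule divide_right_mono) simp
      then show ?thesis
        using N by (simp add: diff_divide_distrib)
    qed
    also have "\<dots> \<le> ?P B (Suc h)"
      unfolding P using sum_mono[of "B - U" "\<lambda>_. 1 - s * h / real (N - 1)", OF IH(1)] card
      by (intro divide_right_mono) (auto simp del: card_Diff_insert)
    finally have lower: "1 - s * Suc h / N \<le> ?P B (Suc h)" .
    have "?P B (Suc h) \<le> (real N - real s) * exp (- (s * h / real (N - 1))) / N"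
      unfolding P using sum_mono[of "B - U" _ "\<lambda>_. exp (- (s * h / real (N - 1)))", OF IH(2)] card
      by (intro divide_right_mono) auto
    also have "\<dots> = (1 - real s / N) * exp (- (s * h / real (N - 1)))"
      using N by (simp add: field_simps)
    \<comment> \<open>Drawing without replacement helps here: replacing \<open>N - 1\<close> by
      \<open>N\<close> in the exponent only weakens the bound.\<close>
    also have "\<dots> \<le> exp (- (real s / N)) * exp (- (real s * h / N))"
    proof (rule mult_mono)
      show "1 - real s / N \<le> exp (- (real s / N))"
        using exp_ge_add_one_self[of "- (real s / N)"] by simp
      have "real s * h / N \<le> s * h / real (N - 1)"
        using N by (cases "N = 1") (auto intro!: divide_left_mono)
      then show "exp (- (s * h / real (N - 1))) \<le> exp (- (real s * h / N))"
        by simp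
    qed auto
    also have "\<dots> = exp (- (s * Suc h / N))"
      using N by (simp add: field_simps flip: exp_add)
    finally show ?case
      using lower by (simp add: algebra_simps N_def s_def)
  qed
  then show "?low B h \<le> ?P B h" "?P B h \<le> ?up B h"
    by auto
qed

section \<open>Disjointness of independent random prefixes\<close>

text \<open>Here \<open>e I\<close> is the sum of \<open>h i * h j\<close> over unordered pairs of
  distinct indices. Adding an instance \<open>x\<close> to pairwise disjoint prefixes means avoiding
  a union of exactly \<open>(\<Sum>i\<in>I. h i)\<close> elements, so the previous lemma applies and
  \<open>e\<close> grows by that number times \<open>h x\<close>.\<close>

lemma prob_random_prefixes_disjoint:
  fixes h :: "'i \<Rightarrow> nat" and B :: "'b set"
  assumes "finite I" "finite B" "\<And>i. i \<in> I \<Longrightarrow> h i \<le> card B"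
  defines "e \<equiv> \<lambda>I. ((\<Sum>i\<in>I. real (h i))\<^sup>2 - (\<Sum>i\<in>I. (real (h i))\<^sup>2)) / 2"
  shows "1 - e I / card B \<le> measure_pmf.prob (Pi_pmf I [] (\<lambda>_. pmf_of_set (permutations_of_set B)))
           {f. disjoint_family_on (\<lambda>i. set (take (h i) (f i))) I}" (is "_ \<le> ?P I")
    and "measure_pmf.prob (Pi_pmf I [] (\<lambda>_. pmf_of_set (permutations_of_set B)))
           {f. disjoint_family_on (\<lambda>i. set (take (h i) (f i))) I} \<le> exp (- (e I / card B))"
proof -
  have "1 - e I / card B \<le> ?P I \<and> ?P I \<le> exp (- (e I / card B))"
    using assms(1,3)
  proof (induction I rule: finite_induct)
    case empty
    then show ?case
      by (simp add: e_def disjoint_family_on_def)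
  next
    case (insert x I)
    define S where "S = (\<lambda>f i. set (take (h i) (f i :: 'b list)))"
    define E where "E = {f. disjoint_family_on (S f) I}"
    define E' where "E' = {f. disjoint_family_on (S f) (insert x I)}"
    define p where "p = pmf_of_set (permutations_of_set B)"
    define q where "q = Pi_pmf I [] (\<lambda>_. p)"
    define y where "y = (\<Sum>i\<in>I. real (h i)) * h x / card B"
    have "e (insert x I) = e I + (\<Sum>i\<in>I. real (h i)) * h x"
      using insert.hyps by (simp add: e_def power2_sum field_simps)
    then have e: "e (insert x I) / card B = e I / card B + y"
      by (simp add: y_def add_divide_distrib)
    have IH: "1 - e I / card B \<le> measure_pmf.prob q E" "measure_pmf.prob q E \<le> exp (- (e I / card B))"
      using insert by (auto simp: q_def p_def E_def S_def)
    \<comment> \<open>The draws are commuted so that \<open>x\<close> comes last and the set it has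
      to avoid is already determined.\<close>
    have P: "?P (insert x I) = measure_pmf.prob (q \<bind> (\<lambda>f. map_pmf (\<lambda>b. f(x := b)) p)) E'"
      unfolding map_pmf_def using insert.hyps
      by (subst bind_commute_pmf) (simp add: Pi_pmf_insert' q_def p_def E'_def S_def)
    have mem: "f(x := b) \<in> E' \<longleftrightarrow> f \<in> E \<and> set (take (h x) b) \<inter> \<Union>(S f ` I) = {}" for f b
    proof -
      have "disjoint_family_on (S (f(x := b))) I = disjoint_family_on (S f) I"
        using insert.hyps by (auto simp: disjoint_family_on_def S_def)
      moreover have "\<Union>(S (f(x := b)) ` I) = \<Union>(S f ` I)"
        using insert.hyps by (intro arg_cong[of _ _ Union] image_cong) (auto simp: S_def)
      ultimately show ?thesis
        using insert.hyps by (auto simp: E'_def E_def disjoint_family_on_insert S_def)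
    qed
    have step: "measure_pmf.prob (map_pmf (\<lambda>b. f(x := b)) p) E' =
        (if f \<in> E then measure_pmf.prob p {b. set (take (h x) b) \<inter> \<Union>(S f ` I) = {}} else 0)" for f
      by (simp add: vimage_def mem)
    have bounds: "1 - y \<le> measure_pmf.prob p {b. set (take (h x) b) \<inter> \<Union>(S f ` I) = {}}"
      "measure_pmf.prob p {b. set (take (h x) b) \<inter> \<Union>(S f ` I) = {}} \<le> exp (- y)"
      if "f \<in> set_pmf q" "f \<in> E" for f
    proof -
      have f: "f i \<in> permutations_of_set B" if "i \<in> I" for i
        using \<open>f \<in> set_pmf q\<close> that insert.hyps assms(2)
        by (auto simp: q_def p_def set_Pi_pmf PiE_dflt_def)
      have "card (S f i) = h i" if "i \<in> I" for i
        using f[OF that] insert.prems[of i] that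
        by (simp add: S_def distinct_card permutations_of_setD length_finite_permutations_of_set)
      moreover have "card (\<Union>(S f ` I)) = (\<Sum>i\<in>I. card (S f i))"
        using insert.hyps \<open>f \<in> E\<close>
        by (intro card_UN_disjoint) (auto simp: S_def E_def disjoint_family_on_def)
      ultimately have card: "real (card (\<Union>(S f ` I))) = (\<Sum>i\<in>I. real (h i))"
        by simp
      have "\<Union>(S f ` I) \<subseteq> B"
        using f by (auto simp: S_def permutations_of_set_def dest: in_set_takeD)
      from prob_random_permutation_prefix_avoids[OF assms(2) this insert.prems[of x]]
      show "1 - y \<le> measure_pmf.prob p {b. set (take (h x) b) \<inter> \<Union>(S f ` I) = {}}"
        "measure_pmf.prob p {b. set (take (h x) b) \<inter> \<Union>(S f ` I) = {}} \<le> exp (- y)"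
        by (auto simp: card p_def y_def)
    qed
    have qP: "measure_pmf.prob q E * (1 - y) \<le> ?P (insert x I)"
      "?P (insert x I) \<le> measure_pmf.prob q E * exp (- y)"
      unfolding P
      by (rule prob_bind_pmf_bounds[where a = "1 - y" and b = "exp (- y)"];
          simp add: step bounds del: measure_map_pmf)+
    \<comment> \<open>Multiplying the two lower bounds would require control of their signs.
      Instead, \<open>prob q E * (1 - y)\<close> is at least \<open>prob q E - y\<close>, because
      \<open>prob q E\<close> is at most 1.\<close>
    have "y \<ge> 0"
      by (auto simp: y_def intro!: sum_nonneg divide_nonneg_nonneg mult_nonneg_nonneg)
    then have "measure_pmf.prob q E * y \<le> y"
      by (simp add: mult_left_le_one_le)
    then have "1 - e (insert x I) / card B \<le> ?P (insert x I)"
      using qP(1) IH(1) by (simp add: e algebra_simps)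
    moreover have "measure_pmf.prob q E * exp (- y) \<le> exp (- (e I / card B)) * exp (- y)"
      by (intro mult_right_mono IH) simp
    then have "?P (insert x I) \<le> exp (- (e (insert x I) / card B))"
      using qP(2) by (simp add: e flip: exp_add)
    ultimately show ?case ..
  qed
  then show "1 - e I / card B \<le> ?P I" "?P I \<le> exp (- (e I / card B))"
    by auto
qed

section \<open>From ID prefixes to opened bins\<close>

lemma concat_nth_equal_lengths:
  assumes "\<forall>ys\<in>set xss. length ys = k" "t < length xss" "r < k"
  shows "concat xss ! (t * k + r) = xss ! t ! r"
  using assms
proof (induction xss arbitrary: t)
  case (Cons ys xss)
  then show ?case
    by (cases t) (auto simp: nth_append)
qed simp

lemma length_concat_equal_lengths:
  assumes "\<forall>ys\<in>set xss. length ys = k"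
  shows "length (concat xss) = length xss * k"
  using assms by (induction xss) auto

text \<open>The deterministic map inside \<open>bins\<close>, named so that the random order of the
  bins can be separated from the IDs it produces.\<close>

definition id_list :: "nat set \<Rightarrow> nat set list \<Rightarrow> nat list" where
  "id_list L bs = concat (map sorted_list_of_set bs) @ sorted_list_of_set L"

text \<open>The quotient is \<open>d / k\<close> rounded up. The cap \<open>N\<close> takes effect
  when the demand reaches into the leftover IDs.\<close>

definition bins_used :: "nat \<Rightarrow> nat \<Rightarrow> nat \<Rightarrow> nat" where
  "bins_used N k d = min N ((d + k - 1) div k)"

text \<open>Counting from zero, the bin at position \<open>t\<close> starts at index
  \<open>t * k\<close>; it is opened exactly when that index is served.\<close>

lemma less_bins_used_iff:
  assumes "k > 0"
  shows "t < bins_used N k d \<longleftrightarrow> t < N \<and> t * k < d"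
proof -
  have "t < (d + k - 1) div k \<longleftrightarrow> Suc t * k \<le> d + k - 1"
    using assms by (simp only: less_eq_div_iff_mult_less_eq flip: Suc_le_eq)
  then show ?thesis
    using assms by (auto simp: bins_used_def)
qed

context
  fixes m k :: nat and \<B> :: "nat set set" and L :: "nat set"
  assumes part: "bin_partition m k \<B> L" and k: "k > 0"
begin

lemma bin_partition_finite:
  shows "finite \<B>" "b \<in> \<B> \<Longrightarrow> finite b" "finite L"
proof -
  have "finite (\<Union>\<B> \<union> L)"
    using part by (simp add: bin_partition_def)
  then show "finite \<B>" "b \<in> \<B> \<Longrightarrow> finite b" "finite L"
    by (auto intro: finite_UnionD finite_subset[of b])
qed

lemma id_list_nth:
  assumes bs: "bs \<in> permutations_of_set \<B>" and "t < m div k" "r < k"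
  shows "id_list L bs ! (t * k + r) = sorted_list_of_set (bs ! t) ! r"
    and "t * k + r < length (id_list L bs)"
proof -
  have len: "length bs = m div k"
    using part bs by (simp add: bin_partition_def length_finite_permutations_of_set)
  have eq: "\<forall>ys\<in>set (map sorted_list_of_set bs). length ys = k"
    using part bs by (auto simp: bin_partition_def permutations_of_set_def)
  have "t * k + r < Suc t * k"
    using assms by simp
  also have "\<dots> \<le> m div k * k"
    using assms by (intro mult_right_mono) auto
  finally have "t * k + r < length (concat (map sorted_list_of_set bs))"
    using length_concat_equal_lengths[OF eq] len by simp
  then show "id_list L bs ! (t * k + r) = sorted_list_of_set (bs ! t) ! r"
    "t * k + r < length (id_list L bs)"
    using concat_nth_equal_lengths[OF eq, of t r] assms len by (auto simp: id_list_def nth_append)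
qed

text \<open>Leftover IDs come after all bins, so an instance that returns one has opened every
  bin.\<close>

lemma set_take_id_list_cases:
  assumes bs: "bs \<in> permutations_of_set \<B>" and x: "x \<in> set (take d (id_list L bs))"
  obtains b where "b \<in> set (take (bins_used (m div k) k d) bs)" "x \<in> b"
  | "x \<in> L" "bins_used (m div k) k d = m div k"
proof -
  have len: "length bs = m div k"
    using part bs by (simp add: bin_partition_def length_finite_permutations_of_set)
  have set: "set bs = \<B>"
    using bs by (simp add: permutations_of_set_def)
  have eq: "\<forall>ys\<in>set (map sorted_list_of_set bs). length ys = k"
    using part bs by (auto simp: bin_partition_def permutations_of_set_def)
  have lenc: "length (concat (map sorted_list_of_set bs)) = m div k * k"
    using length_concat_equal_lengths[OF eq] len by simp
  from x obtain p where p: "p < d" "p < length (id_list L bs)" "id_list L bs ! p = x"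
    by (auto simp: in_set_conv_nth)
  show thesis
  proof (cases "p < m div k * k")
    case True
    define t where "t = p div k"
    define r where "r = p mod k"
    have tr: "t < m div k" "r < k" "p = t * k + r"
      using True k by (auto simp: t_def r_def less_mult_imp_div_less)
    then have "x = sorted_list_of_set (bs ! t) ! r"
      using id_list_nth(1)[OF bs tr(1,2)] p by simp
    moreover have "bs ! t \<in> \<B>"
      using set len tr by auto
    moreover from this have "length (sorted_list_of_set (bs ! t)) = k"
      using part by (auto simp: bin_partition_def)
    ultimately have "x \<in> bs ! t"
      using bin_partition_finite(2) tr(2) nth_mem set_sorted_list_of_set by metis
    moreover have "t < bins_used (m div k) k d"
      using p tr k by (simp add: less_bins_used_iff)
    then have "bs ! t \<in> set (take (bins_used (m div k) k d) bs)"
      using tr(1) len by (auto simp: in_set_conv_nth intro!: exI[of _ t])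
    ultimately show thesis
      using that(1) by blast
  next
    case False
    then have "x \<in> set (sorted_list_of_set L)"
      using p lenc by (auto simp: id_list_def nth_append)
    moreover have "bins_used (m div k) k d = m div k"
    \<comment> \<open>If fewer than \<open>m div k\<close> bins were opened, then \<open>d\<close>
      would be at most \<open>m div k * k\<close>, hence at most \<open>p\<close>, contradicting
      \<open>p < d\<close>.\<close>
    proof (rule ccontr)
      assume "bins_used (m div k) k d \<noteq> m div k"
      then have "bins_used (m div k) k d < m div k"
        by (simp add: bins_used_def min_def split: if_splits)
      then have "\<not> bins_used (m div k) k d * k < d"
        using less_bins_used_iff[OF k, of "bins_used (m div k) k d" "m div k" d] by simp
      moreover have "bins_used (m div k) k d * k \<le> m div k * k"
        by (simp add: bins_used_def)
      ultimately show False
        using False p(1) by linarith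
    qed
    ultimately show thesis
      using that(2) bin_partition_finite(3) by simp
  qed
qed

text \<open>A bin is read in increasing order, so even a partially used bin yields its minimum. Two
  instances sharing a bin therefore share this ID.\<close>

lemma Min_in_set_take_id_list:
  assumes bs: "bs \<in> permutations_of_set \<B>" and b: "b \<in> set (take (bins_used (m div k) k d) bs)"
  shows "Min b \<in> set (take d (id_list L bs))"
proof -
  from b obtain t where t: "t < bins_used (m div k) k d" "t < length bs" "b = bs ! t"
    by (auto simp: in_set_conv_nth)
  then have t': "t < m div k" "t * k < d"
    using k by (auto simp: less_bins_used_iff)
  have "b \<in> \<B>"
    using bs t by (auto simp: permutations_of_set_def)
  then have "finite b" "b \<noteq> {}"
    using part bin_partition_finite k by (auto simp: bin_partition_def)
  then have "Min b = sorted_list_of_set b ! 0"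
    using sorted_list_of_set_nonempty by fastforce
  also have "\<dots> = id_list L bs ! (t * k)"
    using id_list_nth(1)[OF bs t'(1), of 0] k t by simp
  finally show ?thesis
    using id_list_nth(2)[OF bs t'(1), of 0] k t'
    by (auto simp: in_set_conv_nth intro!: exI[of _ "t * k"])
qed

text \<open>A common bin gives its minimum as a common ID. Conversely, a common ID lies in a bin
  opened by both, since bins are disjoint, or it is a leftover; in the latter case one instance
  opened all bins and meets the other, which opened at least one.\<close>

lemma id_list_prefixes_disjoint_iff:
  assumes bs: "bs \<in> permutations_of_set \<B>" "bs' \<in> permutations_of_set \<B>"
    and pos: "d > 0" "d' > 0" and km: "k \<le> m"
  shows "set (take d (id_list L bs)) \<inter> set (take d' (id_list L bs')) = {} \<longleftrightarrow>
    set (take (bins_used (m div k) k d) bs) \<inter> set (take (bins_used (m div k) k d') bs') = {}"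
    (is "?ids \<longleftrightarrow> ?bins")
proof
  assume ?ids
  then show ?bins
    using Min_in_set_take_id_list bs by blast
next
  assume disj: ?bins
  have set: "set bs = \<B>" "set bs' = \<B>"
    using bs by (auto simp: permutations_of_set_def)
  have len: "length bs = m div k" "length bs' = m div k"
    using part bs by (auto simp: bin_partition_def length_finite_permutations_of_set)
  have "0 < m div k"
    using km k by (simp add: div_greater_zero_iff)
  moreover from this have "0 < bins_used (m div k) k d" "0 < bins_used (m div k) k d'"
    using pos k by (simp_all add: less_bins_used_iff)
  ultimately have ne: "set (take (bins_used (m div k) k d) bs) \<noteq> {}"
    "set (take (bins_used (m div k) k d') bs') \<noteq> {}"
    using len by auto
  show ?ids
  proof (rule ccontr)
    assume "\<not> ?ids"
    then obtain x where x: "x \<in> set (take d (id_list L bs))" "x \<in> set (take d' (id_list L bs'))"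
      by blast
    have sub: "set (take (bins_used (m div k) k d) bs) \<subseteq> \<B>"
      "set (take (bins_used (m div k) k d') bs') \<subseteq> \<B>"
      using set set_take_subset by fast+
    \<comment> \<open>An instance that opened every bin meets the nonempty set of bins of the other;
      this discards the leftover case for both instances.\<close>
    have full: False if "bins_used (m div k) k d = m div k \<or> bins_used (m div k) k d' = m div k"
    proof -
      have "set (take (bins_used (m div k) k d) bs) = \<B> \<or>
          set (take (bins_used (m div k) k d') bs') = \<B>"
        using that len set by (metis order_refl take_all)
      then show False
        using disj ne sub by (metis inf.absorb1 inf.absorb2)
    qed
    obtain b where b: "b \<in> set (take (bins_used (m div k) k d) bs)" "x \<in> b"
      by (rule set_take_id_list_cases[OF bs(1) x(1)]) (use full that in blast)+
    moreover obtain b' where b': "b' \<in> set (take (bins_used (m div k) k d') bs')" "x \<in> b'"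
      by (rule set_take_id_list_cases[OF bs(2) x(2)]) (use full that in blast)+
    moreover have "b \<in> \<B>" "b' \<in> \<B>" "disjoint \<B>"
      using b(1) b'(1) sub part by (auto simp: bin_partition_def)
    then have "b = b'"
      using b(2) b'(2) disjointD by fastforce
    ultimately show False
      using disj by blast
  qed
qed

lemma collision_prob_bins_eq:
  assumes D: "\<forall>i\<in>{1..n}. D i > 0" and km: "k \<le> m"
  shows "collision_prob (bins \<B> L) n D =
    1 - measure_pmf.prob (Pi_pmf {1..n} [] (\<lambda>_. pmf_of_set (permutations_of_set \<B>)))
          {f. disjoint_family_on (\<lambda>i. set (take (bins_used (m div k) k (D i)) (f i))) {1..n}}"
proof -
  define p where "p = pmf_of_set (permutations_of_set \<B>)"
  define q where "q = Pi_pmf {1..n} [] (\<lambda>_. p)"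
  \<comment> \<open>The case split is about default values: \<open>id_list L []\<close> is the list
    of leftovers, whereas \<open>collision_prob\<close> uses \<open>[]\<close> outside
    \<open>{1..n}\<close>.\<close>
  define ids where "ids = (\<lambda>f i. if i \<in> {1..n} then id_list L (f i) else [])"
  define E where
    "E = {f :: nat \<Rightarrow> nat set list.
            disjoint_family_on (\<lambda>i. set (take (bins_used (m div k) k (D i)) (f i))) {1..n}}"
  have "bins \<B> L = map_pmf (id_list L) p"
    by (simp add: bins_def p_def id_list_def[abs_def])
  then have "Pi_pmf {1..n} (id_list L []) (\<lambda>_. bins \<B> L) = map_pmf (\<lambda>f. id_list L \<circ> f) q"
    by (simp add: Pi_pmf_map[where dflt = "[]"] q_def)
  then have "Pi_pmf {1..n} [] (\<lambda>_. bins \<B> L) = map_pmf ids q"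
    using Pi_pmf_default_swap[of "{1..n}" "[]" "id_list L []" "\<lambda>_. bins \<B> L"]
    by (simp add: pmf.map_comp o_def ids_def)
  then have "collision_prob (bins \<B> L) n D = measure_pmf.prob q (ids -` {\<pi>. collision n D \<pi>})"
    by (simp add: collision_prob_def)
  also have "\<dots> = measure_pmf.prob q (- E)"
  proof (intro measure_pmf.finite_measure_eq_AE AE_pmfI)
    fix f assume "f \<in> set_pmf q"
    then have "f i \<in> permutations_of_set \<B>" if "i \<in> {1..n}" for i
      using that bin_partition_finite(1) by (auto simp: q_def p_def set_Pi_pmf PiE_dflt_def)
    then show "f \<in> ids -` {\<pi>. collision n D \<pi>} \<longleftrightarrow> f \<in> - E"
      using D km
      by (simp add: collision_def disjoint_family_on_def E_def ids_def id_list_prefixes_disjoint_iff)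
  qed auto
  also have "\<dots> = 1 - measure_pmf.prob q E"
    using measure_pmf.prob_compl[of E q] by (simp add: Compl_eq_Diff_UNIV)
  finally show ?thesis
    by (simp add: q_def p_def E_def)
qed

end

section \<open>Elementary estimates and rounding\<close>

text \<open>The difference is the sum of \<open>a i * a j\<close> over ordered pairs of distinct
  indices, which is monotone for nonnegative entries. It transfers bounds on each \<open>h i\<close>
  to the pair sum.\<close>

lemma sum_power2_minus_sum_power2_mono:
  fixes a b :: "'a \<Rightarrow> real"
  assumes "\<And>i. i \<in> I \<Longrightarrow> 0 \<le> a i" "\<And>i. i \<in> I \<Longrightarrow> a i \<le> b i"
  shows "(\<Sum>i\<in>I. a i)\<^sup>2 - (\<Sum>i\<in>I. (a i)\<^sup>2) \<le> (\<Sum>i\<in>I. b i)\<^sup>2 - (\<Sum>i\<in>I. (b i)\<^sup>2)"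
proof (cases "finite I")
  case True
  have eq: "(\<Sum>i\<in>I. c i)\<^sup>2 - (\<Sum>i\<in>I. (c i)\<^sup>2) = (\<Sum>i\<in>I. c i * (\<Sum>j\<in>I - {i}. c j))"
    for c :: "'a \<Rightarrow> real"
  proof -
    have "(\<Sum>i\<in>I. c i * (\<Sum>j\<in>I - {i}. c j)) = (\<Sum>i\<in>I. c i * ((\<Sum>j\<in>I. c j) - c i))"
      using True by (intro sum.cong refl) (simp add: sum_diff1)
    then show ?thesis
      by (simp add: power2_eq_square algebra_simps sum_subtractf sum_distrib_left)
  qed
  show ?thesis
    unfolding eq using assms
    by (intro sum_mono mult_mono sum_nonneg) (auto intro: order_trans)
qed auto

lemma min_1_half_le_one_minus_exp:
  fixes x y :: real
  assumes "0 \<le> y" "y \<le> x"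
  shows "min 1 y / 2 \<le> 1 - exp (- x)"
proof -
  define z where "z = min 1 y"
  have z: "0 \<le> z" "z \<le> 1" "z \<le> x"
    using assms by (auto simp: z_def)
  have "exp (- x) \<le> exp (- z)"
    using z by simp
  also have "\<dots> = 1 / exp z"
    by (simp add: exp_minus inverse_eq_divide)
  also have "\<dots> \<le> 1 / (1 + z)"
    using z exp_ge_add_one_self[of z] by (intro divide_left_mono) auto
  \<comment> \<open>Since \<open>(1 - z / 2) * (1 + z) = 1 + z * (1 - z) / 2\<close>, and
    \<open>z\<close> lies between 0 and 1.\<close>
  also have "\<dots> \<le> 1 - z / 2"
    using z mult_left_mono[of z 1 z] by (simp add: field_simps)
  finally show ?thesis
    by (simp add: z_def)
qed

text \<open>With \<open>h\<close> bins opened, \<open>d \<le> 2 * h * k\<close> and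
  \<open>1 \<le> h\<close> give \<open>d / k + 1 \<le> 3 * h\<close>. The factor 2 pays for demands
  that reach the leftovers, of which there are fewer than \<open>k\<close>.\<close>

lemma bins_used_bounds:
  assumes "k > 0" "d > 0" "d \<le> m" "k \<le> m"
  shows "real (bins_used (m div k) k d) \<le> d / k + 1"
    and "(d / k + 1) / 3 \<le> real (bins_used (m div k) k d)"
proof -
  have "real ((d + k - 1) div k) \<le> real (d + k - 1) / k"
    by (rule of_nat_div_le_of_nat)
  also have "\<dots> \<le> d / k + 1"
    using assms by (simp add: field_simps)
  finally show "real (bins_used (m div k) k d) \<le> d / k + 1"
    by (simp add: bins_used_def)
  define h where "h = bins_used (m div k) k d"
  have h1: "h \<ge> 1"
    using assms less_bins_used_iff[of k 0 "m div k" d] by (simp add: h_def div_greater_zero_iff)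
  have "d \<le> 2 * h * k"
  proof (cases "h < m div k")
    case True
    then have "d \<le> h * k"
      using less_bins_used_iff[of k h "m div k" d] assms by (simp add: h_def)
    then show ?thesis by simp
  next
    case False
    have "d < (m div k + 1) * k"
      using assms div_mult_mod_eq[of m k] mod_less_divisor[of k m]
      unfolding distrib_right mult_1 by linarith
    also have "\<dots> \<le> (2 * h) * k"
      using False h1 by (intro mult_right_mono) auto
    finally show ?thesis by simp
  qed
  then have "real d \<le> 2 * h * k"
    by (metis of_nat_le_iff of_nat_mult of_nat_numeral)
  then have "d / k \<le> 2 * h"
    using assms by (simp add: field_simps)
  then show "(d / k + 1) / 3 \<le> real (bins_used (m div k) k d)"
    using h1 by (simp add: h_def)
qed

section \<open>The two-sided bound with explicit constants\<close>

theorem theorem3p2: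
  "\<exists>c1 c2 :: real. 0 < c1 \<and> 0 < c2 \<and>
     (\<forall>(m :: nat) (n :: nat) (k :: nat) (D :: nat \<Rightarrow> nat) (\<B> :: nat set set) (L :: nat set).
        n \<ge> 2 \<longrightarrow> (\<forall>i\<in>{1..n}. D i \<in> {1..m}) \<longrightarrow> k \<in> {1..m} \<longrightarrow> bin_partition m k \<B> L \<longrightarrow>
        (let g = min 1 (((norm1 n D)\<^sup>2 - norm2_sq n D) / (real k * real m)
                        + real n * norm1 n D / real m
                        + (real n)\<^sup>2 * real k / real m)
         in c1 * g \<le> collision_prob (bins \<B> L) n D \<and> collision_prob (bins \<B> L) n D \<le> c2 * g))"
proof (rule exI[of _ "1 / 72"], rule exI[of _ 2], intro conjI allI impI)
  \<comment> \<open>The constant 2 comes from \<open>m / k \<le> 2 * N\<close>. The constant 72 is 9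
    (rounding by a factor 3, squared) times 2 (\<open>X b\<close> against
    \<open>G * (m / k)\<close>) times 2 (ordered against unordered pairs) times 2 (from
    \<open>1 - exp (- x)\<close> to \<open>min\<close>).\<close>
  fix m n k :: nat and D :: "nat \<Rightarrow> nat" and \<B> :: "nat set set" and L :: "nat set"
  assume n: "n \<ge> 2" and D: "\<forall>i\<in>{1..n}. D i \<in> {1..m}" and "k \<in> {1..m}"
    and part: "bin_partition m k \<B> L"
  then have k: "k > 0" "k \<le> m" and m: "m > 0"
    by auto
  define G where "G = ((norm1 n D)\<^sup>2 - norm2_sq n D) / (real k * real m)
    + real n * norm1 n D / real m + (real n)\<^sup>2 * real k / real m"
  define h where "h = (\<lambda>i. bins_used (m div k) k (D i))"
  define b where "b = (\<lambda>i. D i / k + 1)"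
  \<comment> \<open>The sum over ordered pairs, so that \<open>X h / 2\<close> is the exponent
    numerator \<open>e\<close>.\<close>
  define X where "X = (\<lambda>a :: nat \<Rightarrow> real. (\<Sum>i=1..n. a i)\<^sup>2 - (\<Sum>i=1..n. (a i)\<^sup>2))"
  define p where "p = collision_prob (bins \<B> L) n D"
  define N where "N = m div k"
  have p_le_1: "p \<le> 1"
    by (simp add: p_def collision_prob_def)
  have hb: "h i \<le> b i" "b i / 3 \<le> h i" if "i \<in> {1..n}" for i
  proof -
    have "D i > 0" "D i \<le> m"
      using bspec[OF D that] by auto
    then show "h i \<le> b i" "b i / 3 \<le> h i"
      using k bins_used_bounds[of k "D i" m] by (simp_all add: h_def b_def)
  qed
  have card: "card \<B> = N" and finB: "finite \<B>"
    using part bin_partition_finite(1)[OF part] k by (auto simp: bin_partition_def N_def)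
  define q where "q = measure_pmf.prob (Pi_pmf {1..n} [] (\<lambda>_. pmf_of_set (permutations_of_set \<B>)))
    {f. disjoint_family_on (\<lambda>i. set (take (h i) (f i))) {1..n}}"
  have "h i \<le> card \<B>" for i
    by (simp add: h_def card bins_used_def N_def)
  then have "1 - X h / 2 / N \<le> q" "q \<le> exp (- (X h / 2 / N))"
    using prob_random_prefixes_disjoint[of "{1..n}" \<B> h] finB
    unfolding X_def q_def card by blast+
  moreover have "p = 1 - q"
    unfolding p_def q_def h_def using D
    by (intro collision_prob_bins_eq[OF part k(1) _ k(2)]) (auto simp: Suc_le_eq)
  ultimately have p: "p \<le> X h / 2 / N" "1 - exp (- (X h / 2 / N)) \<le> p"
    by simp_all
  define r where "r = ((norm1 n D)\<^sup>2 - norm2_sq n D) / k\<^sup>2"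
  define t where "t = norm1 n D / k"
  \<comment> \<open>The three summands match those of \<open>G * (m / k)\<close>, namely
    \<open>r\<close>, \<open>n * t\<close> and the square of \<open>n\<close>, up to factors between
    1/2 and 2.\<close>
  have Xb: "X b = r + 2 * (real n - 1) * t + real n * (real n - 1)"
  proof -
    have s1: "(\<Sum>i=1..n. b i) = norm1 n D / k + n"
      by (simp add: b_def norm1_def sum.distrib sum_divide_distrib)
    have s2: "(\<Sum>i=1..n. (b i)\<^sup>2) = norm2_sq n D / k\<^sup>2 + 2 * norm1 n D / k + n"
      by (simp add: b_def norm1_def norm2_sq_def power2_sum sum.distrib power_divide
          sum_divide_distrib sum_distrib_left mult.assoc)
    show ?thesis
      unfolding X_def s1 s2 r_def t_def using k by (simp add: field_simps power2_eq_square)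
  qed
  have Q: "0 \<le> (norm1 n D)\<^sup>2 - norm2_sq n D"
    using sum_power2_minus_sum_power2_mono[of "{1..n}" "\<lambda>_. 0" D] by (simp add: norm1_def norm2_sq_def)
  have T: "0 \<le> norm1 n D"
    by (simp add: norm1_def sum_nonneg)
  have G: "G * (m / k) = r + n * t + (real n)\<^sup>2"
    using k m by (simp add: G_def r_def t_def field_simps power2_eq_square)
  have G0: "G \<ge> 0"
    using Q T unfolding G_def by (intro add_nonneg_nonneg divide_nonneg_nonneg mult_nonneg_nonneg) auto
  have rt: "0 \<le> r" "0 \<le> t"
    using T Q by (simp_all add: r_def t_def divide_nonneg_nonneg)
  have "2 * (real n - 1) * t \<le> 2 * n * t"
    by (rule mult_right_mono; use rt in simp)
  \<comment> \<open>Here \<open>n \<ge> 2\<close> enters, as \<open>n \<le> 2 * (n - 1)\<close>; the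
    same inequality bounds the last summand from below.\<close>
  moreover have nt: "n * t \<le> 2 * (real n - 1) * t"
    by (rule mult_right_mono; use rt n in simp)
  moreover have "real n * (real n - 1) \<le> 2 * (real n)\<^sup>2"
    unfolding power2_eq_square mult.left_commute[of 2] by (rule mult_left_mono) simp_all
  ultimately have XG_upper: "X b \<le> 2 * (G * (m / k))"
    unfolding Xb G using rt by simp
  have "real n * 2 \<le> real n * real n"
    using n by (intro mult_left_mono) auto
  then have "(real n)\<^sup>2 / 2 \<le> real n * (real n - 1)"
    unfolding power2_eq_square right_diff_distrib by linarith
  moreover have "0 \<le> n * t"
    using rt by simp
  ultimately have XG_lower: "G * (m / k) / 2 \<le> X b"
    unfolding Xb G using rt nt by argo
  have Xh: "X h \<le> X b" "X b / 9 \<le> X h"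
  proof -
    show "X h \<le> X b"
      unfolding X_def using hb by (intro sum_power2_minus_sum_power2_mono) auto
    have "X (\<lambda>i. b i / 3) \<le> X h"
      unfolding X_def using hb by (intro sum_power2_minus_sum_power2_mono) (auto simp: b_def)
    moreover have "X (\<lambda>i. b i / 3) = X b / 9"
      by (simp add: X_def power_divide diff_divide_distrib flip: sum_divide_distrib)
    ultimately show "X b / 9 \<le> X h"
      by simp
  qed
  have N: "N > 0"
    using k by (simp add: N_def div_greater_zero_iff)
  have Nm: "real N \<le> m / k" "m / k \<le> 2 * N"
  proof -
    show "real N \<le> m / k"
      unfolding N_def by (rule of_nat_div_le_of_nat)
    have "m < (N + 1) * k"
      using k div_mult_mod_eq[of m k] mod_less_divisor[of k m]
      unfolding N_def distrib_right mult_1 by linarith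
    also have "\<dots> \<le> (2 * N) * k"
      using N by (intro mult_right_mono) auto
    finally have "real m \<le> 2 * N * k"
      by (metis less_imp_le of_nat_le_iff of_nat_mult of_nat_numeral)
    then show "m / k \<le> 2 * N"
      using k by (simp add: field_simps)
  qed
  have "X h / 2 \<le> G * (m / k)"
    using Xh XG_upper by linarith
  also have "\<dots> \<le> G * (2 * N)"
    using Nm G0 by (intro mult_left_mono)
  finally have "X h / 2 / N \<le> 2 * G"
    using N by (simp add: field_simps)
  then have upper: "p \<le> 2 * min 1 G"
    using p p_le_1 by (simp add: min_def)
  have "G / 36 * N \<le> G / 36 * (m / k)"
    using Nm G0 by (intro mult_left_mono) auto
  also have "\<dots> \<le> X h / 2"
    using Xh XG_lower by simp
  finally have "G / 36 \<le> X h / 2 / N"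
    using N by (simp add: field_simps)
  then have "min 1 (G / 36) / 2 \<le> p"
    using min_1_half_le_one_minus_exp[of "G / 36" "X h / 2 / N"] G0 p by simp
  then have lower: "1 / 72 * min 1 G \<le> p"
    using G0 by (auto simp: min_def split: if_splits)
  show "let g = min 1 (((norm1 n D)\<^sup>2 - norm2_sq n D) / (real k * real m)
                        + real n * norm1 n D / real m
                        + (real n)\<^sup>2 * real k / real m)
         in 1 / 72 * g \<le> collision_prob (bins \<B> L) n D \<and> collision_prob (bins \<B> L) n D \<le> 2 * g"
    using lower upper unfolding p_def G_def Let_def by blast
qed auto

end
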